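(* Consider the adjacent-categories logit model with nonproportional odds: $\log(\pi_{ij}/\pi_{i,j+1})=\mathbf h_j^T(\mathbf x_i)\boldsymbol\beta_j$ for $i=1,\dots,m$, $j=1,\dots,J-1$. Suppose $\mathbf h_1(\mathbf x_i)=\cdots=\mathbf h_{J-1}(\mathbf x_i)$ for all $i=1,\dots,m$. Then all orders of response categories are equivalent; that is, $\sigma_1\sim\sigma_2$ for all permutations $\sigma_1,\sigma_2$ of $\{1,\dots,J\}$.
   Context: Setting. Let $d\ge1$, $m\ge1$, $J\ge3$. The data are $\{(\mathbf x_i,\mathbf Y_i): i=1,\dots,m\}$, where $\mathbf x_1,\dots,\mathbf x_m\in\mathbb R^d$ are distinct covariate settings and $\mathbf Y_i=(Y_{i1},\dots,Y_{iJ})^T$ is a vector of nonnegative integer counts with $n_i=\sum_{j=1}^JY_{ij}>0$. The model assumes $\mathbf Y_i\sim\mathrm{Multinomial}(n_i;\pi_{i1},\dots,\pi_{iJ})$ independently over $i$, with $\pi_{ij}>0$ and $\sum_{j=1}^J\pi_{ij}=1$. Model. $\mathbf h_j:\mathbb R^d\to\mathbb R^{p_j}$ ($j=1,\dots,J-1$) are known predictor functions (under the hypothesis of the claim, all $p_j$ are equal), and the unknown parameter is $\boldsymbol\theta=(\boldsymbol\beta_1^T,\dots,\boldsymbol\beta_{J-1}^T)^T$ with $\boldsymbol\beta_j\in\mathbb R^{p_j}$, ranging over $\boldsymbol\Theta=\mathbb R^p$, $p=p_1+\cdots+p_{J-1}$. For $\boldsymbol\theta\in\boldsymbol\Theta$,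 $(\pi_{i1}(\boldsymbol\theta),\dots,\pi_{iJ}(\boldsymbol\theta))$ denotes the unique positive probability vector satisfying the model equations at $\mathbf x_i$. Orders and equivalence. An order is a permutation $\sigma$ of $\{1,\dots,J\}$. Fitting the model with order $\sigma$ means fitting it to the permuted data $\mathbf Y_i^\sigma=(Y_{i\sigma(1)},\dots,Y_{i\sigma(J)})^T$, so the likelihood function with order $\sigma$ is $$L_\sigma(\boldsymbol\theta)=\prod_{i=1}^m\frac{n_i!}{\prod_{j=1}^JY_{i\sigma(j)}!}\prod_{j=1}^J\pi_{ij}(\boldsymbol\theta)^{Y_{i\sigma(j)}} .$$ Two orders are equivalent, $\sigma_1\sim\sigma_2$, if $\sup_{\boldsymbol\theta\in\boldsymbol\Theta}L_{\sigma_1}(\boldsymbol\theta)=\sup_{\boldsymbol\theta\in\boldsymbol\Theta}L_{\sigma_2}(\boldsymbol\theta)$. *)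

theory Defs
  imports "HOL-Analysis.Analysis" "HOL-Combinatorics.Permutations"
begin

text \<open>Categories are indexed by \<open>{1..J}\<close> and covariate settings by \<open>{1..m}\<close>. Since the predictor
  functions take values in a common space, the type \<open>real ^ 'p\<close> serves as the codomain of every
  predictor and as the space of every coefficient vector.\<close>

text \<open>Vectors indexed by a finite set of naturals are extensional functions, so that parameters
  and probability vectors are determined by their entries.\<close>

definition param_space :: "nat \<Rightarrow> (nat \<Rightarrow> real ^ 'p) set" where
  "param_space J = {1..J - 1} \<rightarrow>\<^sub>E UNIV"

definition pos_prob_vector :: "nat \<Rightarrow> (nat \<Rightarrow> real) \<Rightarrow> bool" where
  "pos_prob_vector J q \<longleftrightarrow>
     q \<in> extensional {1..J} \<and> (\<forall>j\<in>{1..J}. 0 < q j) \<and> (\<Sum>j\<in>{1..J}. q j) = 1"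

definition adjacent_logit_eqs ::
  "nat \<Rightarrow> (nat \<Rightarrow> 'x \<Rightarrow> real ^ 'p) \<Rightarrow> (nat \<Rightarrow> real ^ 'p) \<Rightarrow> 'x \<Rightarrow> (nat \<Rightarrow> real) \<Rightarrow> bool" where
  "adjacent_logit_eqs J h \<beta> z q \<longleftrightarrow>
     (\<forall>j\<in>{1..J - 1}. ln (q j / q (j + 1)) = h j z \<bullet> \<beta> j)"

definition adjacent_logit_prob ::
  "nat \<Rightarrow> (nat \<Rightarrow> 'x \<Rightarrow> real ^ 'p) \<Rightarrow> (nat \<Rightarrow> real ^ 'p) \<Rightarrow> 'x \<Rightarrow> nat \<Rightarrow> real" where
  "adjacent_logit_prob J h \<beta> z =
     (THE q. pos_prob_vector J q \<and> adjacent_logit_eqs J h \<beta> z q)"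

text \<open>\<open>P i j\<close> is the probability of category \<open>j\<close> at the \<open>i\<close>-th setting; the counts are read in the
  order \<open>\<sigma>\<close>.\<close>

definition order_likelihood ::
  "nat \<Rightarrow> nat \<Rightarrow> (nat \<Rightarrow> nat \<Rightarrow> nat) \<Rightarrow> (nat \<Rightarrow> nat \<Rightarrow> real) \<Rightarrow> (nat \<Rightarrow> nat) \<Rightarrow> real" where
  "order_likelihood J m Y P \<sigma> =
     (\<Prod>i\<in>{1..m}. fact (\<Sum>j\<in>{1..J}. Y i j) / (\<Prod>j\<in>{1..J}. fact (Y i (\<sigma> j)))
        * (\<Prod>j\<in>{1..J}. P i j ^ Y i (\<sigma> j)))"

text \<open>Only used for likelihoods bounded above on \<open>\<Theta>\<close>, where the supremum in \<open>real\<close> is the genuine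
  one; see \<open>bdd_above_order_likelihood\<close> below.\<close>

definition order_equiv ::
  "nat \<Rightarrow> nat \<Rightarrow> (nat \<Rightarrow> nat \<Rightarrow> nat) \<Rightarrow> 't set \<Rightarrow> ('t \<Rightarrow> nat \<Rightarrow> nat \<Rightarrow> real)
     \<Rightarrow> (nat \<Rightarrow> nat) \<Rightarrow> (nat \<Rightarrow> nat) \<Rightarrow> bool" where
  "order_equiv J m Y \<Theta> P \<sigma>\<^sub>1 \<sigma>\<^sub>2 \<longleftrightarrow>
     (SUP \<theta>\<in>\<Theta>. order_likelihood J m Y (P \<theta>) \<sigma>\<^sub>1) = (SUP \<theta>\<in>\<Theta>. order_likelihood J m Y (P \<theta>) \<sigma>\<^sub>2)"

lemma adjacent_logit_ex1:
  fixes h :: "nat \<Rightarrow> 'x \<Rightarrow> real ^ 'p"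
  assumes "J \<ge> 1"
  shows "\<exists>!q. pos_prob_vector J q \<and> adjacent_logit_eqs J h \<beta> z q"
proof -
  define w where "w j = exp (\<Sum>k\<in>{j..<J}. h k z \<bullet> \<beta> k)" for j
  define S where "S = (\<Sum>j\<in>{1..J}. w j)"
  have w_pos: "w j > 0" for j by (simp add: w_def)
  have w_step: "w j = exp (h j z \<bullet> \<beta> j) * w (Suc j)" if "j < J" for j
    using that by (simp add: w_def sum.atLeast_Suc_lessThan exp_add)
  have S_pos: "S > 0"
    unfolding S_def using assms w_pos by (intro sum_pos) auto
  define q0 where "q0 = restrict (\<lambda>j. w j / S) {1..J}"
  have "pos_prob_vector J q0"
    using w_pos S_pos
    by (auto simp: pos_prob_vector_def q0_def S_def simp flip: sum_divide_distrib)
  moreover have "adjacent_logit_eqs J h \<beta> z q0"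
    unfolding adjacent_logit_eqs_def
  proof
    fix j assume j: "j \<in> {1..J - 1}"
    then have "j < J" by auto
    then have "q0 j / q0 (j + 1) = exp (h j z \<bullet> \<beta> j)"
      using j w_step[of j] w_pos[of "Suc j"] S_pos by (simp add: q0_def)
    then show "ln (q0 j / q0 (j + 1)) = h j z \<bullet> \<beta> j" by simp
  qed
  moreover have "q = q0" if q: "pos_prob_vector J q" and e: "adjacent_logit_eqs J h \<beta> z q" for q
  proof -
    have pos: "q j > 0" if "1 \<le> j" "j \<le> J" for j
      using q that by (auto simp: pos_prob_vector_def)
    have qw: "1 \<le> j \<longrightarrow> q j = q J * w j" if "j \<le> J" for j
      using that
    proof (induction j rule: inc_induct)
      case base
      then show ?case by (simp add: w_def)
    next
      case (step j)
      show ?case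
      proof
        assume j: "1 \<le> j"
        have p: "q j > 0" "q (Suc j) > 0" using pos j step.hyps by auto
        have "ln (q j / q (Suc j)) = h j z \<bullet> \<beta> j"
          using e j step.hyps by (simp add: adjacent_logit_eqs_def)
        then have "q j / q (Suc j) = exp (h j z \<bullet> \<beta> j)"
          using p by (metis divide_pos_pos exp_ln)
        then have "q j = exp (h j z \<bullet> \<beta> j) * q (Suc j)"
          using p by (simp add: field_simps)
        then show "q j = q J * w j"
          using step.IH w_step[of j] step.hyps by simp
      qed
    qed
    have "1 = (\<Sum>j\<in>{1..J}. q j)"
      using q by (simp add: pos_prob_vector_def)
    also have "\<dots> = q J * S"
      unfolding S_def sum_distrib_left
    proof (rule sum.cong[OF refl])
      fix j assume "j \<in> {1..J}"
      then show "q j = q J * w j" using qw[of j] by simp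
    qed
    finally have qJ: "q J = 1 / S" using S_pos by (simp add: field_simps)
    show ?thesis
    proof (rule extensionalityI[of _ "{1..J}"])
      show "q \<in> extensional {1..J}" using q by (simp add: pos_prob_vector_def)
      show "q0 \<in> extensional {1..J}" by (simp add: q0_def)
      fix j assume j: "j \<in> {1..J}"
      then have "q j = 1 / S * w j" using qw[of j] unfolding qJ by simp
      then show "q j = q0 j" using j by (simp add: q0_def)
    qed
  qed
  ultimately show ?thesis by blast
qed

lemma bdd_above_order_likelihood:
  assumes "\<And>\<theta> i. \<theta> \<in> \<Theta> \<Longrightarrow> i \<in> {1..m} \<Longrightarrow> pos_prob_vector J (P \<theta> i)"
  shows "bdd_above ((\<lambda>\<theta>. order_likelihood J m Y (P \<theta>) \<sigma>) ` \<Theta>)"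
proof (rule bdd_aboveI2)
  fix \<theta> assume \<theta>: "\<theta> \<in> \<Theta>"
  let ?c = "\<lambda>i. fact (\<Sum>j\<in>{1..J}. Y i j) / (\<Prod>j\<in>{1..J}. fact (Y i (\<sigma> j))) :: real"
  have P: "0 \<le> P \<theta> i j \<and> P \<theta> i j \<le> 1" if "i \<in> {1..m}" "j \<in> {1..J}" for i j
  proof -
    have p: "\<forall>j\<in>{1..J}. 0 < P \<theta> i j" and s: "(\<Sum>j\<in>{1..J}. P \<theta> i j) = 1"
      using assms[OF \<theta> that(1)] by (auto simp: pos_prob_vector_def)
    have "P \<theta> i j \<le> (\<Sum>j\<in>{1..J}. P \<theta> i j)"
      using p that(2) by (intro member_le_sum) (auto intro: less_imp_le)
    then show ?thesis using p s that(2) by (auto intro: less_imp_le)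
  qed
  show "order_likelihood J m Y (P \<theta>) \<sigma> \<le> (\<Prod>i\<in>{1..m}. ?c i)"
    unfolding order_likelihood_def
  proof (rule prod_mono, intro conjI)
    fix i assume i: "i \<in> {1..m}"
    have c: "0 \<le> ?c i" by (intro divide_nonneg_nonneg prod_nonneg) auto
    have "0 \<le> (\<Prod>j\<in>{1..J}. P \<theta> i j ^ Y i (\<sigma> j))"
      using P[OF i] by (intro prod_nonneg) auto
    then show "0 \<le> ?c i * (\<Prod>j\<in>{1..J}. P \<theta> i j ^ Y i (\<sigma> j))"
      using c by (rule mult_nonneg_nonneg[rotated])
    have "(\<Prod>j\<in>{1..J}. P \<theta> i j ^ Y i (\<sigma> j)) \<le> 1"
      using P[OF i] by (intro prod_le_1) (auto intro: power_le_one)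
    then show "?c i * (\<Prod>j\<in>{1..J}. P \<theta> i j ^ Y i (\<sigma> j)) \<le> ?c i"
      using c by (rule mult_left_le)
  qed
qed

end

(* Set c j = b_j + ... + b_{J-1}. When the predictors share a common value g at x_i, the model says that
   log pi_ij = g . c j up to a constant depending only on i, with arbitrary contrasts c. Permuting
   the categories permutes the vectors c j, hence is a reparametrization of the same model, and
   the likelihoods of any two orders have the same range. *)

theory Submission
  imports Defs
begin

lemma adjacent_logit_prob_eqI:
  fixes h :: "nat \<Rightarrow> 'x \<Rightarrow> real ^ 'p"
  assumes "J \<ge> 1" "pos_prob_vector J q" "adjacent_logit_eqs J h \<beta> z q"
  shows "adjacent_logit_prob J h \<beta> z = q"
  unfolding adjacent_logit_prob_def
  by (rule the1_equality[OF adjacent_logit_ex1[OF assms(1)]]) (simp add: assms)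

lemma adjacent_logit_prob_spec:
  fixes h :: "nat \<Rightarrow> 'x \<Rightarrow> real ^ 'p"
  assumes "J \<ge> 1"
  shows "pos_prob_vector J (adjacent_logit_prob J h \<beta> z)"
    and "adjacent_logit_eqs J h \<beta> z (adjacent_logit_prob J h \<beta> z)"
  using theI'[OF adjacent_logit_ex1[OF assms, of h \<beta> z]]
  unfolding adjacent_logit_prob_def by auto

lemma pos_prob_vector_permute:
  assumes "pos_prob_vector J q" "\<rho> permutes {1..J}"
  shows "pos_prob_vector J (q \<circ> \<rho>)"
proof -
  \<comment> \<open>Both directions matter: indices outside \<open>{1..J}\<close> stay outside, so
    \<open>q \<circ> \<rho>\<close> keeps the value \<open>undefined\<close> there and remains
    extensional.\<close>
  have "\<rho> j \<in> {1..J} \<longleftrightarrow> j \<in> {1..J}" for j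
    using permutes_in_image[OF assms(2)] .
  moreover have "(\<Sum>j\<in>{1..J}. q j) = (\<Sum>j\<in>{1..J}. q (\<rho> j))"
    using sum.permute[OF assms(2), of q] by (simp add: o_def)
  ultimately show ?thesis
    using assms(1) unfolding pos_prob_vector_def extensional_def o_def mem_Collect_eq by metis
qed

text \<open>The adjacent log-ratios telescope from \<open>j\<close> up to the baseline category
  \<open>J\<close>, and the common predictor value \<open>g\<close> factors out of the sum.\<close>

lemma ln_adjacent_logit:
  fixes h :: "nat \<Rightarrow> 'x \<Rightarrow> real ^ 'p"
  assumes q: "pos_prob_vector J q" and e: "adjacent_logit_eqs J h \<beta> z q"
    and g: "\<And>j. j \<in> {1..J - 1} \<Longrightarrow> h j z = g"
    and j: "j \<in> {1..J}"
  shows "ln (q j) = ln (q J) + g \<bullet> (\<Sum>k\<in>{j..<J}. \<beta> k)"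
proof -
  from j have "j \<le> J" by simp
  \<comment> \<open>The induction descends from \<open>J\<close>; the guard \<open>1 \<le> j\<close>
    sits inside the formula because the model equations start at index 1.\<close>
  then have "1 \<le> j \<longrightarrow> ln (q j) = ln (q J) + g \<bullet> (\<Sum>k\<in>{j..<J}. \<beta> k)"
  proof (induction j rule: inc_induct)
    case base
    then show ?case by simp
  next
    case (step n)
    show ?case
    proof
      assume n: "1 \<le> n"
      have "q n > 0" "q (Suc n) > 0"
        using q n step.hyps by (auto simp: pos_prob_vector_def)
      moreover have "ln (q n / q (Suc n)) = g \<bullet> \<beta> n"
        using e g[of n] n step.hyps by (auto simp: adjacent_logit_eqs_def)
      ultimately show "ln (q n) = ln (q J) + g \<bullet> (\<Sum>k\<in>{n..<J}. \<beta> k)"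
        using step.IH step.hyps by (simp add: ln_div sum.atLeast_Suc_lessThan inner_add_right)
    qed
  qed
  then show ?thesis using j by simp
qed

text \<open>The new parameter is built from \<open>\<beta>\<close> and \<open>\<rho>\<close> alone,
  so a single \<open>\<beta>'\<close> serves every \<open>z\<close> at which the predictors agree.
  This uniformity is what lets it act on all settings of the likelihood at once.\<close>

lemma adjacent_logit_prob_permute:
  fixes h :: "nat \<Rightarrow> 'x \<Rightarrow> real ^ 'p"
  assumes J: "J \<ge> 1" and \<rho>: "\<rho> permutes {1..J}"
  obtains \<beta>' where "\<beta>' \<in> param_space J"
    and "\<And>z. (\<And>j k. j \<in> {1..J - 1} \<Longrightarrow> k \<in> {1..J - 1} \<Longrightarrow> h j z = h k z) \<Longrightarrow>
           adjacent_logit_prob J h \<beta>' z = adjacent_logit_prob J h \<beta> z \<circ> \<rho>"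
proof
  define c where "c j = (\<Sum>k\<in>{j..<J}. \<beta> k)" for j
  \<comment> \<open>Forced by the equations: the log-ratio of the permuted probabilities at
    \<open>j\<close> and \<open>j + 1\<close> is the common predictor times this difference. The
    case where \<open>\<rho>\<close> hits \<open>J\<close> is covered by \<open>c J = 0\<close>, an
    empty sum.\<close>
  define \<beta>' where "\<beta>' = restrict (\<lambda>j. c (\<rho> j) - c (\<rho> (j + 1))) {1..J - 1}"
  show "\<beta>' \<in> param_space J"
    by (simp add: \<beta>'_def param_space_def)
  fix z assume h: "\<And>j k. j \<in> {1..J - 1} \<Longrightarrow> k \<in> {1..J - 1} \<Longrightarrow> h j z = h k z"
  let ?q = "adjacent_logit_prob J h \<beta> z"
  note q = adjacent_logit_prob_spec[OF J, of h \<beta> z]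
  have ln_q: "ln (?q j) = ln (?q J) + h 1 z \<bullet> c j" if "j \<in> {1..J}" for j
    unfolding c_def by (rule ln_adjacent_logit[OF q _ that], rule h) auto
  show "adjacent_logit_prob J h \<beta>' z = ?q \<circ> \<rho>"
  \<comment> \<open>By uniqueness of the solution, it suffices that the permuted vector satisfies
    the equations for \<open>\<beta>'\<close>.\<close>
  proof (rule adjacent_logit_prob_eqI[OF J pos_prob_vector_permute[OF q(1) \<rho>]])
    show "adjacent_logit_eqs J h \<beta>' z (?q \<circ> \<rho>)"
      unfolding adjacent_logit_eqs_def
    proof
      fix j assume j: "j \<in> {1..J - 1}"
      then have in_J: "\<rho> j \<in> {1..J}" "\<rho> (j + 1) \<in> {1..J}"
        unfolding permutes_in_image[OF \<rho>] by auto
      then have "?q (\<rho> j) > 0" "?q (\<rho> (j + 1)) > 0"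
        using q(1) unfolding pos_prob_vector_def by blast+
      then have "ln (?q (\<rho> j) / ?q (\<rho> (j + 1))) = h 1 z \<bullet> (c (\<rho> j) - c (\<rho> (j + 1)))"
        using ln_q[OF in_J(1)] ln_q[OF in_J(2)] by (simp add: ln_div inner_diff_right)
      moreover have "h 1 z = h j z"
        using j by (intro h) auto
      ultimately show "ln ((?q \<circ> \<rho>) j / (?q \<circ> \<rho>) (j + 1)) = h j z \<bullet> \<beta>' j"
        using j by (simp add: \<beta>'_def)
    qed
  qed
qed

text \<open>Reindexing the products over categories by \<open>\<rho>\<close> moves the permutation
  from the order onto the probabilities; the total count is the same for every order.\<close>

lemma order_likelihood_permute:
  assumes \<rho>: "\<rho> permutes {1..J}" and P': "\<And>i. i \<in> {1..m} \<Longrightarrow> P' i = P i \<circ> \<rho>"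
  shows "order_likelihood J m Y P' (\<sigma> \<circ> \<rho>) = order_likelihood J m Y P \<sigma>"
  unfolding order_likelihood_def
proof (rule prod.cong[OF refl])
  fix i assume i: "i \<in> {1..m}"
  have "(\<Prod>j\<in>{1..J}. fact (Y i (\<sigma> j)) :: real) = (\<Prod>j\<in>{1..J}. fact (Y i ((\<sigma> \<circ> \<rho>) j)))"
    using prod.permute[OF \<rho>, of "\<lambda>j. fact (Y i (\<sigma> j)) :: real"] by (simp add: o_def)
  moreover have "(\<Prod>j\<in>{1..J}. P i j ^ Y i (\<sigma> j)) = (\<Prod>j\<in>{1..J}. P' i j ^ Y i ((\<sigma> \<circ> \<rho>) j))"
    using prod.permute[OF \<rho>, of "\<lambda>j. P i j ^ Y i (\<sigma> j)"] P'[OF i] by (simp add: o_def)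
  ultimately show "fact (\<Sum>j\<in>{1..J}. Y i j) / (\<Prod>j\<in>{1..J}. fact (Y i ((\<sigma> \<circ> \<rho>) j)))
      * (\<Prod>j\<in>{1..J}. P' i j ^ Y i ((\<sigma> \<circ> \<rho>) j)) =
    fact (\<Sum>j\<in>{1..J}. Y i j) / (\<Prod>j\<in>{1..J}. fact (Y i (\<sigma> j)))
      * (\<Prod>j\<in>{1..J}. P i j ^ Y i (\<sigma> j))"
    by simp
qed

theorem theorem2p6:
  fixes J m :: nat
    and x :: "nat \<Rightarrow> real ^ 'd"
    and Y :: "nat \<Rightarrow> nat \<Rightarrow> nat"
    and h :: "nat \<Rightarrow> real ^ 'd \<Rightarrow> real ^ 'p"
    and \<sigma>\<^sub>1 \<sigma>\<^sub>2 :: "nat \<Rightarrow> nat"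
  assumes "m \<ge> 1" and "J \<ge> 3"
    and "inj_on x {1..m}"
    and "\<And>i. i \<in> {1..m} \<Longrightarrow> (\<Sum>j\<in>{1..J}. Y i j) > 0"
    and "\<And>i j k. i \<in> {1..m} \<Longrightarrow> j \<in> {1..J - 1} \<Longrightarrow> k \<in> {1..J - 1} \<Longrightarrow> h j (x i) = h k (x i)"
    and "\<sigma>\<^sub>1 permutes {1..J}" and "\<sigma>\<^sub>2 permutes {1..J}"
  shows "order_equiv J m Y (param_space J) (\<lambda>\<theta> i. adjacent_logit_prob J h \<theta> (x i)) \<sigma>\<^sub>1 \<sigma>\<^sub>2"
proof -
  let ?P = "\<lambda>\<theta> i. adjacent_logit_prob J h \<theta> (x i)"
  let ?L = "\<lambda>\<sigma> \<theta>. order_likelihood J m Y (?P \<theta>) \<sigma>"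
  have J: "J \<ge> 1" using assms(2) by simp
  \<comment> \<open>The suprema are compared through the ranges of the likelihoods. One inclusion
    for an arbitrary pair of orders suffices, since the pair can be swapped.\<close>
  have "?L \<sigma> ` param_space J \<subseteq> ?L \<tau> ` param_space J"
    if \<sigma>: "\<sigma> permutes {1..J}" and \<tau>: "\<tau> permutes {1..J}" for \<sigma> \<tau>
  proof (rule image_subsetI)
    fix \<theta> :: "nat \<Rightarrow> real ^ 'p" assume "\<theta> \<in> param_space J"
    \<comment> \<open>The solution of \<open>\<tau> = \<sigma> \<circ> \<rho>\<close>: the passage
      from one order to the other becomes a permutation of the model categories.\<close>
    define \<rho> where "\<rho> = inv \<sigma> \<circ> \<tau>"
    have \<rho>: "\<rho> permutes {1..J}"
      unfolding \<rho>_def by (rule permutes_compose[OF \<tau> permutes_inv[OF \<sigma>]])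
    have \<tau>_eq: "\<tau> = \<sigma> \<circ> \<rho>"
      unfolding \<rho>_def using permutes_inv_o(1)[OF \<sigma>] by (simp add: o_assoc)
    obtain \<theta>' where \<theta>': "\<theta>' \<in> param_space J"
      and perm: "\<And>z. (\<And>j k. j \<in> {1..J - 1} \<Longrightarrow> k \<in> {1..J - 1} \<Longrightarrow> h j z = h k z) \<Longrightarrow>
        adjacent_logit_prob J h \<theta>' z = adjacent_logit_prob J h \<theta> z \<circ> \<rho>"
      using adjacent_logit_prob_permute[OF J \<rho>, of h \<theta>] by blast
    have "?L \<tau> \<theta>' = ?L \<sigma> \<theta>"
      unfolding \<tau>_eq by (intro order_likelihood_permute[OF \<rho>] perm) (rule assms(5))
    then show "?L \<sigma> \<theta> \<in> ?L \<tau> ` param_space J"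
      using \<theta>' by (intro image_eqI[of _ _ \<theta>']) simp_all
  qed
  then have "?L \<sigma>\<^sub>1 ` param_space J = ?L \<sigma>\<^sub>2 ` param_space J"
    using assms(6,7) by blast
  then show ?thesis
    unfolding order_equiv_def by simp
qed

end
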